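(* Let $D\in\mathcal{D}_d$, $d\ge 2$, and suppose the random vector $\mathbf X=(X_1,\ldots,X_d)$ has a density $g\in\mathcal{A}(D)$. If the bivariate projection $D_{12}$ of $D$ on the $(x_1,x_2)$-coordinate plane is blunt, then $X_1$ and $X_2$ are asymptotically independent.
   Context: A set $D\subset\mathbb{R}^d$ is star-shaped if $\mathbf x\in D$ implies $r\mathbf x\in D$ for $0<r<1$. For a non-empty bounded open star-shaped set $D$, let $D_\infty=\bigcup_{n>0} nD$ (an open cone), with gauge function $n_D(\mathbf x)=\inf\{t>0:\mathbf x\in tD\}$ on $D_\infty$. $\mathcal{D}_d$ is the class of all (non-empty) bounded open star-shaped sets $D\subset\mathbb{R}^d$ for which $D_\infty$ is convex, $n_D$ is continuous on $D_\infty$, and $D=\{\mathbf x\in D_\infty: n_D(\mathbf x)<1\}$. For $D\in\mathcal{D}_d$, a continuous positive probability density $g$ on $\mathbb{R}^d$ belongs to $\mathcal{A}(D)$ if there exist sequences $c_n>0$ and $r_n\to\infty$ with $c_{n+1}/c_n\to 0$ and $r_{n+1}/r_n\to 1$ such that for every $\epsilon>0$, for all sufficiently large $n$, $e^{-\epsilon}r_nD\subset\{g>c_n\}\subset e^{\epsilon}r_nD$. $D_{12}=\{(x_1,x_2):\mathbf x\in D\}\subset\mathbb{R}^2$. A bounded open star-shaped planar set $E$ is blunt if its coordinatewise supremum $(b_1,b_2)$, $b_i=\sup\{x_i:(x_1,x_2)\in E\}$, does not lie in the closure of $E$. Asymptotic independence: let $(X,Y)$ be a random vector with distribution function $F$ with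 continuous marginals $F_1,F_2$. Let $P$ be the function on $[0,1]^2$ determined by $P(F_1(x),F_2(y))=\mathbb{P}\{X>x,Y>y\}$; equivalently $P(u,v)=1+C(u,v)-u-v$ where $C$ is the copula of $F$. Then $X$ and $Y$ are asymptotically independent if $P(1-s,1-s)=o(s)$ as $s\downarrow 0$. *)

theory Defs
  imports "HOL-Probability.Probability"
begin

definition star_shaped :: "'a::real_vector set \<Rightarrow> bool" where
  "star_shaped D \<longleftrightarrow> (\<forall>x\<in>D. \<forall>r. 0 < r \<and> r < 1 \<longrightarrow> r *\<^sub>R x \<in> D)"

definition scale_set :: "real \<Rightarrow> 'a::real_vector set \<Rightarrow> 'a set" where
  "scale_set t D = (\<lambda>x. t *\<^sub>R x) ` D"

definition cone_of :: "'a::real_vector set \<Rightarrow> 'a set" where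
  "cone_of D = (\<Union>n\<in>{0::nat<..}. scale_set (real n) D)"

text \<open>Only meaningful for \<open>x \<in> cone_of D\<close>; elsewhere the infimum may be taken over the empty set.\<close>

definition set_gauge :: "'a::real_vector set \<Rightarrow> 'a \<Rightarrow> real" where
  "set_gauge D x = Inf {t. 0 < t \<and> x \<in> scale_set t D}"

definition shape_class :: "'a::euclidean_space set set" where
  "shape_class = {D. D \<noteq> {} \<and> bounded D \<and> open D \<and> star_shaped D \<and>
     convex (cone_of D) \<and> continuous_on (cone_of D) (set_gauge D) \<and>
     D = {x \<in> cone_of D. set_gauge D x < 1}}"

definition density_class :: "'a::euclidean_space set \<Rightarrow> ('a \<Rightarrow> real) set" where
  "density_class D = {g. continuous_on UNIV g \<and> (\<forall>x. 0 < g x) \<and>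
     prob_space (density lborel (\<lambda>x. ennreal (g x))) \<and>
     (\<exists>(c::nat \<Rightarrow> real) (r::nat \<Rightarrow> real).
        (\<forall>n. 0 < c n) \<and> filterlim r at_top sequentially \<and>
        (\<lambda>n. c (Suc n) / c n) \<longlonglongrightarrow> 0 \<and> (\<lambda>n. r (Suc n) / r n) \<longlonglongrightarrow> 1 \<and>
        (\<forall>\<epsilon>>0. \<forall>\<^sub>F n in sequentially.
           scale_set (exp (-\<epsilon>) * r n) D \<subseteq> {x. g x > c n} \<and>
           {x. g x > c n} \<subseteq> scale_set (exp \<epsilon> * r n) D))}"

definition coord_proj :: "'n::finite \<Rightarrow> 'n \<Rightarrow> (real ^ 'n) set \<Rightarrow> (real \<times> real) set" where
  "coord_proj i j D = (\<lambda>x. (x $ i, x $ j)) ` D"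

text \<open>Used for non-empty bounded open star-shaped planar sets, for which both suprema are genuine.\<close>

definition blunt :: "(real \<times> real) set \<Rightarrow> bool" where
  "blunt E \<longleftrightarrow> (Sup (fst ` E), Sup (snd ` E)) \<notin> closure E"

definition is_joint_exceedance ::
  "'w measure \<Rightarrow> ('w \<Rightarrow> real) \<Rightarrow> ('w \<Rightarrow> real) \<Rightarrow> (real \<Rightarrow> real \<Rightarrow> real) \<Rightarrow> bool" where
  "is_joint_exceedance M X Y P \<longleftrightarrow>
     (\<forall>x y. P (cdf (distr M borel X) x) (cdf (distr M borel Y) y)
            = measure M {\<omega> \<in> space M. X \<omega> > x \<and> Y \<omega> > y})"

text \<open>For continuous marginals the defining equation determines \<open>P\<close> on the open unit square,
  by the following lemma; this is all that enters the limit \<open>s \<down> 0\<close> below.\<close>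

lemma cdf_surj_open_unit:
  assumes "prob_space M" "X \<in> borel_measurable M"
    and cont: "continuous_on UNIV (cdf (distr M borel X))" and u: "0 < u" "u < 1"
  shows "\<exists>x. cdf (distr M borel X) x = u"
proof -
  interpret prob_space M by fact
  interpret D: real_distribution "distr M borel X"
    using assms(2) by (rule real_distribution_distr)
  have "\<forall>\<^sub>F x in at_bot. cdf (distr M borel X) x < u"
    using D.cdf_lim_at_bot u(1) by (rule order_tendstoD(2))
  then obtain a where a: "\<And>x. x \<le> a \<Longrightarrow> cdf (distr M borel X) x < u"
    by (auto simp: eventually_at_bot_linorder)
  have "\<forall>\<^sub>F x in at_top. cdf (distr M borel X) x > u"
    using D.cdf_lim_at_top_prob u(2) by (rule order_tendstoD(1))
  then obtain b where b: "\<And>x. x \<ge> b \<Longrightarrow> cdf (distr M borel X) x > u"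
    by (auto simp: eventually_at_top_linorder)
  have "\<exists>x\<ge>min a b. x \<le> max a b \<and> cdf (distr M borel X) x = u"
    by (rule IVT') (use a[of "min a b"] b[of "max a b"] in
        \<open>auto intro: continuous_on_subset[OF cont]\<close>)
  then show ?thesis by blast
qed

lemma is_joint_exceedance_unique:
  assumes "prob_space M" "X \<in> borel_measurable M" "Y \<in> borel_measurable M"
    and "continuous_on UNIV (cdf (distr M borel X))" "continuous_on UNIV (cdf (distr M borel Y))"
    and "is_joint_exceedance M X Y P" "is_joint_exceedance M X Y Q"
    and "0 < u" "u < 1" "0 < v" "v < 1"
  shows "P u v = Q u v"
  using cdf_surj_open_unit[OF assms(1,2,4,8,9)] cdf_surj_open_unit[OF assms(1,3,5,10,11)] assms(6,7)
  unfolding is_joint_exceedance_def by metis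

definition asymptotically_independent ::
  "'w measure \<Rightarrow> ('w \<Rightarrow> real) \<Rightarrow> ('w \<Rightarrow> real) \<Rightarrow> bool" where
  "asymptotically_independent M X Y \<longleftrightarrow>
     continuous_on UNIV (cdf (distr M borel X)) \<and>
     continuous_on UNIV (cdf (distr M borel Y)) \<and>
     (\<exists>P. is_joint_exceedance M X Y P \<and>
          (\<lambda>s. P (1 - s) (1 - s)) \<in> o[at_right 0](\<lambda>s. s))"

end

theory Submission imports Defs begin

text \<open>The level sets of \<open>g\<close> look like dilates of \<open>D\<close>, and \<open>g\<close> drops by an unbounded factor between
  two dilates whose ratio is a fixed \<open>exp a > 1\<close>, while volumes change only by a bounded factor.
  Hence the mass outside \<open>exp a * t * D\<close> is negligible compared with the mass of \<open>t * H\<close>,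
  for every open \<open>H\<close> that meets \<open>D\<close>. Taking for \<open>H\<close> half-spaces \<open>z $ i > u\<close> shows that equal tail
  probabilities of \<open>X $ i\<close> and \<open>X $ j\<close> occur at levels \<open>x, y\<close> with \<open>(x, y)\<close> close to a multiple
  \<open>t * b\<close> of the coordinatewise supremum \<open>b\<close>. By bluntness the event \<open>X $ i > x \<and> X $ j > y\<close> then lies
  outside a dilate of \<open>D\<close> with factor larger than \<open>t\<close>, so its probability is negligible
  compared with that of \<open>X $ i > x\<close>.\<close>

section \<open>Dilates: volume and inclusion\<close>

lemma measure_lborel_scale_set:
  fixes D :: "'a::euclidean_space set"
  assumes "open D" "0 < t"
  shows "measure lborel (scale_set t D) = t ^ DIM('a) * measure lborel D"
proof -
  have "open (scale_set t D)"
    using assms by (auto simp: scale_set_def)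
  then show ?thesis
    using measure_lebesgue_affine[of t 0 D] assms
    by (simp add: scale_set_def)
qed

lemma open_scale_set: "open D \<Longrightarrow> 0 < t \<Longrightarrow> open (scale_set t (D :: 'a::real_normed_vector set))"
  by (auto simp: scale_set_def)

lemma bounded_scale_set: "bounded D \<Longrightarrow> bounded (scale_set t (D :: 'a::real_normed_vector set))"
  by (auto simp: scale_set_def intro: bounded_scaling)

lemma mem_scale_set_iff: "t \<noteq> 0 \<Longrightarrow> x \<in> scale_set t D \<longleftrightarrow> inverse t *\<^sub>R x \<in> D"
  by (force simp: scale_set_def image_iff)

lemma scale_set_mono_of_star_shaped:
  assumes "star_shaped D" "0 < s" "s \<le> t"
  shows "scale_set s D \<subseteq> scale_set t D"
proof
  fix x assume "x \<in> scale_set s D"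
  then obtain y where y: "y \<in> D" "x = s *\<^sub>R y" by (auto simp: scale_set_def)
  \<comment> \<open>Star-shapedness only speaks of factors strictly below 1, so \<open>s = t\<close>
    is a case of its own.\<close>
  have "(s / t) *\<^sub>R y \<in> D"
    using assms y by (cases "s = t") (auto simp: star_shaped_def)
  moreover have "x = t *\<^sub>R ((s / t) *\<^sub>R y)" using assms y by simp
  ultimately show "x \<in> scale_set t D" unfolding scale_set_def by (rule rev_image_eqI)
qed

section \<open>Mass estimates from pointwise bounds on the density\<close>

context
  fixes g :: "'a::euclidean_space \<Rightarrow> real" and A :: "'a set" and c :: real
  assumes g: "g \<in> borel_measurable borel" "\<And>x. 0 \<le> g x"
    and fin: "finite_measure (density lborel (\<lambda>x. ennreal (g x)))"
    and A: "A \<in> sets borel" "emeasure lborel A < \<infinity>" and c: "0 \<le> c"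
begin

interpretation finite_measure "density lborel (\<lambda>x. ennreal (g x))" by (fact fin)

lemma measure_density_le:
  assumes "\<And>x. x \<in> A \<Longrightarrow> g x \<le> c"
  shows "measure (density lborel (\<lambda>x. ennreal (g x))) A \<le> c * measure lborel A"
proof -
  have "emeasure (density lborel (\<lambda>x. ennreal (g x))) A = (\<integral>\<^sup>+ x. ennreal (g x) * indicator A x \<partial>lborel)"
    using A g by (intro emeasure_density) auto
  also have "\<dots> \<le> (\<integral>\<^sup>+ x. ennreal c * indicator A x \<partial>lborel)"
    using assms by (intro nn_integral_mono) (auto simp: indicator_def intro: ennreal_leI)
  also have "\<dots> = ennreal c * emeasure lborel A"
    using A by (intro nn_integral_cmult_indicator) auto
  also have "\<dots> = ennreal (c * measure lborel A)"
    using A c by (simp add: emeasure_eq_ennreal_measure ennreal_mult)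
  finally show ?thesis using c by (simp add: emeasure_eq_measure)
qed

lemma measure_density_ge:
  assumes "\<And>x. x \<in> A \<Longrightarrow> c \<le> g x"
  shows "c * measure lborel A \<le> measure (density lborel (\<lambda>x. ennreal (g x))) A"
proof -
  have "ennreal (c * measure lborel A) = ennreal c * emeasure lborel A"
    using A c by (simp add: emeasure_eq_ennreal_measure ennreal_mult)
  also have "\<dots> = (\<integral>\<^sup>+ x. ennreal c * indicator A x \<partial>lborel)"
    using A by (intro nn_integral_cmult_indicator[symmetric]) auto
  also have "\<dots> \<le> (\<integral>\<^sup>+ x. ennreal (g x) * indicator A x \<partial>lborel)"
    using assms by (intro nn_integral_mono) (auto simp: indicator_def intro: ennreal_leI)
  also have "\<dots> = emeasure (density lborel (\<lambda>x. ennreal (g x))) A"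
    using A g by (intro emeasure_density[symmetric]) auto
  finally show ?thesis by (simp add: emeasure_eq_measure)
qed

end

text \<open>On the shell \<open>C (Suc k) - C k\<close> the density is at most \<open>c k\<close>, and these bounds sum like a
  geometric series.\<close>

lemma measure_Compl_le_geometric:
  fixes g :: "'a::euclidean_space \<Rightarrow> real" and C :: "nat \<Rightarrow> 'a set" and c :: "nat \<Rightarrow> real"
  assumes g: "g \<in> borel_measurable borel" "\<And>x. 0 < g x"
    and fin: "finite_measure (density lborel (\<lambda>x. ennreal (g x)))"
    and C: "\<And>k. open (C k)" "\<And>k. bounded (C k)"
    and c: "\<And>k. 0 < c k" "c \<longlonglongrightarrow> 0" "\<And>k. {x. g x > c k} \<subseteq> C k"
    and half: "\<And>k. c (Suc k) * measure lborel (C (Suc (Suc k))) \<le> c k * measure lborel (C (Suc k)) / 2"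
  shows "measure (density lborel (\<lambda>x. ennreal (g x))) (- C 0) \<le> 2 * (c 0 * measure lborel (C (Suc 0)))"
proof -
  let ?\<nu> = "density lborel (\<lambda>x. ennreal (g x))"
  let ?w = "\<lambda>k. c k * measure lborel (C (Suc k))"
  interpret finite_measure ?\<nu> by (fact fin)
  define S where "S k = C (Suc k) - C k" for k
  have S: "S k \<in> sets borel" for k using C(1) by (auto simp: S_def)
  have cover: "- C 0 \<subseteq> (\<Union>k. S k)"
  proof
    fix x assume "x \<in> - C 0"
    have "\<forall>\<^sub>F k in sequentially. c k < g x"
      using c(2) g(2) by (rule order_tendstoD)
    then obtain k where "c k < g x" by (auto simp: eventually_sequentially)
    then have "x \<in> C k" using c(3) by auto
    \<comment> \<open>The sets \<open>C k\<close> need not increase. The first one containing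
      \<open>x\<close> still places \<open>x\<close> in the shell just before it; overlaps between
      shells are harmless, since countable subadditivity is enough below.\<close>
    define k' where "k' = (LEAST k. x \<in> C k)"
    have k': "x \<in> C k'" unfolding k'_def using \<open>x \<in> C k\<close> by (rule LeastI)
    then obtain l where l: "k' = Suc l" using \<open>x \<in> - C 0\<close> by (cases k') auto
    then have "x \<notin> C l" using not_less_Least[of l "\<lambda>k. x \<in> C k"] unfolding k'_def by simp
    then have "x \<in> S l" using k' l by (simp add: S_def)
    then show "x \<in> (\<Union>k. S k)" by blast
  qed
  have w: "?w k \<le> ?w 0 * (1/2) ^ k" for k
  proof (induction k)
    case (Suc k)
    have "?w (Suc k) \<le> ?w k / 2" by (rule half)
    also have "\<dots> \<le> ?w 0 * (1/2) ^ k / 2" using Suc by (intro divide_right_mono) auto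
    finally show ?case by simp
  qed simp
  have le: "measure ?\<nu> (S k) \<le> ?w 0 * (1/2) ^ k" for k
  proof -
    have fl: "emeasure lborel (C (Suc k)) < \<infinity>" by (intro emeasure_bounded_finite C(2))
    have "measure ?\<nu> (S k) \<le> c k * measure lborel (S k)"
    proof (rule measure_density_le)
      show "emeasure lborel (S k) < \<infinity>"
        by (rule emeasure_bounded_finite, rule bounded_subset[OF C(2), of _ "Suc k"]) (auto simp: S_def)
      show "g x \<le> c k" if "x \<in> S k" for x
      proof (rule ccontr)
        assume "\<not> g x \<le> c k"
        then have "x \<in> C k" using c(3)[of k] by auto
        then show False using that by (simp add: S_def)
      qed
    qed (use g c fin S in \<open>auto simp: less_imp_le\<close>)
    also have "measure lborel (S k) \<le> measure lborel (C (Suc k))"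
      using C(1) S fl by (intro measure_mono_fmeasurable) (auto simp: S_def fmeasurable_def)
    then have "c k * measure lborel (S k) \<le> ?w k"
      using c(1)[of k] by simp
    also note w[of k]
    finally show ?thesis by simp
  qed
  have sm: "summable (\<lambda>k. ?w 0 * (1/2) ^ k)" by (intro summable_mult summable_geometric) auto
  then have sS: "summable (\<lambda>k. measure ?\<nu> (S k))"
    by (rule summable_comparison_test'[where N=0]) (use le in auto)
  have "measure ?\<nu> (- C 0) \<le> measure ?\<nu> (\<Union>k. S k)"
    using cover S by (intro finite_measure_mono) auto
  also have "\<dots> \<le> (\<Sum>k. measure ?\<nu> (S k))"
    using S sS by (intro finite_measure_subadditive_countably) auto
  also have "\<dots> \<le> (\<Sum>k. ?w 0 * (1/2) ^ k)"
    by (intro suminf_le le sS sm)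
  also have "\<dots> = 2 * ?w 0"
    by (subst suminf_mult) (auto simp: suminf_geometric summable_geometric)
  finally show ?thesis .
qed

section \<open>Mass outside a larger dilate\<close>

lemma tendsto_zero_if_ratio_tendsto_zero:
  fixes c :: "nat \<Rightarrow> real"
  assumes c: "\<And>n. 0 < c n" and "(\<lambda>n. c (Suc n) / c n) \<longlonglongrightarrow> 0"
  shows "c \<longlonglongrightarrow> 0"
proof -
  have "\<forall>\<^sub>F n in sequentially. c (Suc n) / c n < 1/2"
    using assms(2) by (rule order_tendstoD) auto
  then obtain N where "\<And>n. n \<ge> N \<Longrightarrow> c (Suc n) / c n < 1/2" by (auto simp: eventually_sequentially)
  then have "summable c"
    using c by (intro summable_ratio_test[of "1/2" N]) (auto simp: divide_simps abs_of_pos less_imp_le)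
  then show ?thesis by (rule summable_LIMSEQ_zero)
qed

text \<open>Let \<open>m\<close> be the first index from \<open>N\<close> on with \<open>r m\<close>
  at least \<open>exp \<epsilon> * t\<close>. The inner mass is at least a constant times
  \<open>c m * t ^ DIM('a)\<close>, the outer mass at most a constant times
  \<open>c (Suc m) * t ^ DIM('a)\<close>. As \<open>c (Suc m) / c m\<close> tends to 0, it beats
  both constants and \<open>\<delta>\<close>.\<close>

lemma exterior_negligible:
  fixes D H :: "'a::euclidean_space set"
  assumes D: "D \<in> shape_class" and g: "g \<in> density_class D"
    and H: "open H" "H \<inter> D \<noteq> {}" and "0 < a" "0 < \<delta>"
  shows "\<forall>\<^sub>F t in at_top. measure (density lborel (\<lambda>x. ennreal (g x))) (- scale_set (exp a * t) D)
           < \<delta> * measure (density lborel (\<lambda>x. ennreal (g x))) (scale_set t H)"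
proof -
  let ?\<nu> = "density lborel (\<lambda>x. ennreal (g x))"
  let ?d = "DIM('a)" let ?V = "measure lborel D" let ?W = "measure lborel (H \<inter> D)"
  \<comment> \<open>\<open>exp a\<close> is spent in four factors \<open>exp \<epsilon>\<close>: the
    definition of \<open>\<tau>\<close>, the overshoot of \<open>r m\<close> over
    \<open>\<tau>\<close>, the passage to \<open>r (Suc m)\<close>, and the outer inclusion of the
    level set.\<close>
  define \<epsilon> where "\<epsilon> = a / 4"
  have \<epsilon>: "0 < \<epsilon>" "a = 4 * \<epsilon>" using \<open>0 < a\<close> by (auto simp: \<epsilon>_def)
  have oD: "open D" and bD: "bounded D" and sD: "star_shaped D"
    using D by (auto simp: shape_class_def)
  have gc: "continuous_on UNIV g" and gp: "\<And>x. 0 < g x" and pr: "prob_space ?\<nu>"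
    using g by (auto simp: density_class_def)
  have gm: "g \<in> borel_measurable borel" using gc by (rule borel_measurable_continuous_onI)
  interpret prob_space ?\<nu> by (fact pr)
  have fm: "finite_measure ?\<nu>" by unfold_locales
  obtain c r :: "nat \<Rightarrow> real" where c: "\<And>n. 0 < c n" and r: "filterlim r at_top sequentially"
    and cr: "(\<lambda>n. c (Suc n) / c n) \<longlonglongrightarrow> 0" and rr: "(\<lambda>n. r (Suc n) / r n) \<longlonglongrightarrow> 1"
    and lev: "\<And>\<epsilon>. 0 < \<epsilon> \<Longrightarrow> \<forall>\<^sub>F n in sequentially.
           scale_set (exp (-\<epsilon>) * r n) D \<subseteq> {x. g x > c n} \<and>
           {x. g x > c n} \<subseteq> scale_set (exp \<epsilon> * r n) D"
    using g by (auto simp: density_class_def)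
  have "?W > 0"
  proof -
    have "\<not> negligible (H \<inter> D)" using H oD by (intro open_not_negligible) auto
    moreover have "H \<inter> D \<in> lmeasurable"
      using H oD bD by (intro lmeasurable_open) (auto intro: bounded_Int)
    ultimately have "measure lebesgue (H \<inter> D) \<noteq> 0"
      by (simp add: negligible_iff_measure)
    then show ?thesis using H oD by (simp add: zero_less_measure_iff)
  qed
  have "c \<longlonglongrightarrow> 0" using c cr by (rule tendsto_zero_if_ratio_tendsto_zero)
  \<comment> \<open>The levels drop faster than the volumes grow, so from some index on the shell
    bounds at least halve at every step.\<close>
  have "((\<lambda>n. c (Suc n) / c n * (r (Suc (Suc n)) / r (Suc n)) ^ ?d)) \<longlonglongrightarrow> 0 * 1 ^ ?d"
    using LIMSEQ_Suc[OF rr] by (intro tendsto_intros cr)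
  then have half: "\<forall>\<^sub>F n in sequentially. c (Suc n) / c n * (r (Suc (Suc n)) / r (Suc n)) ^ ?d < 1/2"
    by (intro order_tendstoD(2)) auto
  \<comment> \<open>Solved from the final comparison of outer and inner mass: the 2 sums the
    geometric series, \<open>exp (5 * \<epsilon>) * t\<close> bounds the outermost radius, and
    \<open>?V + 1\<close> makes the denominator positive at once.\<close>
  define \<gamma> where "\<gamma> = \<delta> * ?W / (2 * exp (5 * \<epsilon>) ^ ?d * (?V + 1))"
  have "\<gamma> > 0" using \<open>?W > 0\<close> \<open>0 < \<delta>\<close> by (auto simp: \<gamma>_def intro!: divide_pos_pos mult_pos_pos add_nonneg_pos)
  have "\<forall>\<^sub>F n in sequentially. r n > 0 \<and> r (Suc n) / r n < exp \<epsilon> \<and> c (Suc n) / c n < \<gamma>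
     \<and> c (Suc n) / c n * (r (Suc (Suc n)) / r (Suc n)) ^ ?d < 1/2 \<and> scale_set (exp (-\<epsilon>) * r n) D \<subseteq> {x. g x > c n} \<and>
           {x. g x > c n} \<subseteq> scale_set (exp \<epsilon> * r n) D"
    using \<epsilon>(1) \<open>\<gamma> > 0\<close>
    by (intro eventually_conj half order_tendstoD(2)[OF rr] order_tendstoD(2)[OF cr])
       (use lev[of \<epsilon>] r in \<open>auto simp: eventually_conj_iff filterlim_at_top_dense\<close>)
  then obtain N where N: "\<And>n. n \<ge> N \<Longrightarrow> r n > 0" "\<And>n. n \<ge> N \<Longrightarrow> r (Suc n) / r n < exp \<epsilon>"
    "\<And>n. n \<ge> N \<Longrightarrow> c (Suc n) / c n < \<gamma>"
    "\<And>n. n \<ge> N \<Longrightarrow> c (Suc n) / c n * (r (Suc (Suc n)) / r (Suc n)) ^ ?d < 1/2"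
    "\<And>n. n \<ge> N \<Longrightarrow> scale_set (exp (-\<epsilon>) * r n) D \<subseteq> {x. g x > c n}"
    "\<And>n. n \<ge> N \<Longrightarrow> {x. g x > c n} \<subseteq> scale_set (exp \<epsilon> * r n) D"
    by (auto simp: eventually_sequentially)
  have rS: "r (Suc n) < exp \<epsilon> * r n" if "n \<ge> N" for n
    using N(1,2)[OF that] by (simp add: divide_simps)
  have upper: "measure ?\<nu> (- scale_set (exp \<epsilon> * r n) D) \<le> 2 * (c n * ((exp \<epsilon> * r (Suc n)) ^ ?d * ?V))"
    if "n \<ge> N" for n
  proof -
    define C where "C k = scale_set (exp \<epsilon> * r (n + k)) D" for k
    have vol: "measure lborel (C k) = (exp \<epsilon> * r (n + k)) ^ ?d * ?V" for k
      using N(1)[of "n + k"] that oD by (simp add: C_def measure_lborel_scale_set)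
    have "measure ?\<nu> (- C 0) \<le> 2 * (c (n + 0) * measure lborel (C (Suc 0)))"
    proof (rule measure_Compl_le_geometric[where c = "\<lambda>k. c (n + k)"])
      fix k
      show "open (C k)" "bounded (C k)"
        using N(1)[of "n + k"] that oD bD by (auto simp: C_def open_scale_set bounded_scale_set)
      show "{x. g x > c (n + k)} \<subseteq> C k" using N(6)[of "n + k"] that by (simp add: C_def)
      have pos: "r (Suc (n + k)) > 0" "r (Suc (Suc (n + k))) > 0" "c (n + k) > 0"
        using N(1) that c by auto
      have "c (Suc (n + k)) * r (Suc (Suc (n + k))) ^ ?d \<le> c (n + k) * r (Suc (n + k)) ^ ?d / 2"
        using N(4)[of "n + k"] that pos by (simp add: divide_simps mult.commute split: if_splits)
      from mult_right_mono[OF this, of "exp \<epsilon> ^ ?d * ?V"]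
      show "c (n + Suc k) * measure lborel (C (Suc (Suc k))) \<le> c (n + k) * measure lborel (C (Suc k)) / 2"
        by (simp add: vol power_mult_distrib mult_ac)
    qed (use gm gp fm c LIMSEQ_ignore_initial_segment[OF \<open>c \<longlonglongrightarrow> 0\<close>, of n] in \<open>auto simp: add.commute\<close>)
    then show ?thesis unfolding vol by (simp add: C_def)
  qed
  have main: "measure ?\<nu> (- scale_set (exp a * t) D) < \<delta> * measure ?\<nu> (scale_set t H)"
    if "t > r N" for t
  proof -
    have "t > 0" using that N(1)[of N] by auto
    \<comment> \<open>From \<open>\<tau> \<le> r m\<close> follows
      \<open>t \<le> exp (-\<epsilon>) * r m\<close>, which puts \<open>scale_set t D\<close> inside
      the level set of \<open>c m\<close>.\<close>
    define \<tau> where "\<tau> = exp \<epsilon> * t"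
    have "\<tau> > t" using \<open>t > 0\<close> \<epsilon> by (simp add: \<tau>_def)
    have "\<forall>\<^sub>F n in sequentially. r n \<ge> \<tau> \<and> n \<ge> N"
      using r by (intro eventually_conj eventually_ge_at_top) (auto simp: filterlim_at_top)
    then have ex: "\<exists>n. n \<ge> N \<and> r n \<ge> \<tau>" by (auto simp: eventually_sequentially)
    \<comment> \<open>The sequence \<open>r\<close> need not be monotone, but consecutive terms are close, so the first term
      above \<open>\<tau>\<close> is not much larger than \<open>\<tau>\<close>.\<close>
    define m where "m = (LEAST n. n \<ge> N \<and> r n \<ge> \<tau>)"
    have m: "m \<ge> N" "r m \<ge> \<tau>" using LeastI_ex[OF ex] by (auto simp: m_def)
    \<comment> \<open>Because \<open>r N < t < \<tau>\<close>, the predecessor of \<open>m\<close>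
      is still at least \<open>N\<close>, where the ratio bound on \<open>r\<close> holds.\<close>
    have "m \<noteq> N" using m that \<open>\<tau> > t\<close> by auto
    then obtain l where l: "m = Suc l" "l \<ge> N" using m by (cases m) auto
    have "r l < \<tau>"
      using not_less_Least[of l "\<lambda>n. n \<ge> N \<and> r n \<ge> \<tau>"] l by (fold m_def) auto
    have b1: "r m \<le> exp (2 * \<epsilon>) * t"
    proof -
      have "r m \<le> exp \<epsilon> * r l" using rS[of l] l by simp
      also have "\<dots> \<le> exp \<epsilon> * \<tau>" using \<open>r l < \<tau>\<close> by simp
      finally show ?thesis by (simp add: \<tau>_def mult_exp_exp flip: mult.assoc)
    qed
    have b2: "r (Suc m) \<le> exp (3 * \<epsilon>) * t"
    proof -
      have "r (Suc m) \<le> exp \<epsilon> * r m" using rS[of m] m by simp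
      also have "\<dots> \<le> exp \<epsilon> * (exp (2 * \<epsilon>) * t)" using b1 by simp
      finally show ?thesis by (simp add: mult_exp_exp flip: mult.assoc)
    qed
    have b3: "r (Suc (Suc m)) \<le> exp (4 * \<epsilon>) * t"
    proof -
      have "r (Suc (Suc m)) \<le> exp \<epsilon> * r (Suc m)" using rS[of "Suc m"] m by simp
      also have "\<dots> \<le> exp \<epsilon> * (exp (3 * \<epsilon>) * t)" using b2 by simp
      finally show ?thesis by (simp add: mult_exp_exp flip: mult.assoc)
    qed
    have pos: "0 < r m" "0 < r (Suc m)" "0 < r (Suc (Suc m))" using N(1) m by auto
    \<comment> \<open>The exterior is estimated from index \<open>Suc m\<close> on, so that its
      bound carries \<open>c (Suc m)\<close>, while the inner mass carries
      \<open>c m\<close>.\<close>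
    have "scale_set (exp \<epsilon> * r (Suc m)) D \<subseteq> scale_set (exp a * t) D"
    proof (rule scale_set_mono_of_star_shaped[OF sD])
      have "exp \<epsilon> * r (Suc m) \<le> exp \<epsilon> * (exp (3 * \<epsilon>) * t)" using b2 by simp
      then show "exp \<epsilon> * r (Suc m) \<le> exp a * t" by (simp add: \<epsilon>(2) mult_exp_exp flip: mult.assoc)
    qed (use pos in auto)
    then have "measure ?\<nu> (- scale_set (exp a * t) D) \<le> measure ?\<nu> (- scale_set (exp \<epsilon> * r (Suc m)) D)"
      using borel_comp[OF borel_open[OF open_scale_set[OF oD, of "exp \<epsilon> * r (Suc m)"]]] pos
      by (intro finite_measure_mono) auto
    also have "\<dots> \<le> 2 * (c (Suc m) * ((exp \<epsilon> * r (Suc (Suc m))) ^ ?d * ?V))"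
      using m by (intro upper) auto
    also have "\<dots> \<le> 2 * (c (Suc m) * ((exp (5 * \<epsilon>) * t) ^ ?d * (?V + 1)))"
    proof -
      have "exp \<epsilon> * r (Suc (Suc m)) \<le> exp \<epsilon> * (exp (4 * \<epsilon>) * t)" using b3 by simp
      also have "\<dots> = exp (5 * \<epsilon>) * t" by (simp add: mult_exp_exp flip: mult.assoc)
      finally have "(exp \<epsilon> * r (Suc (Suc m))) ^ ?d \<le> (exp (5 * \<epsilon>) * t) ^ ?d"
        using pos by (intro power_mono) auto
      then have "(exp \<epsilon> * r (Suc (Suc m))) ^ ?d * ?V \<le> (exp (5 * \<epsilon>) * t) ^ ?d * (?V + 1)"
        by (rule mult_mono) (use \<open>t > 0\<close> in auto)
      then show ?thesis using c[of "Suc m"] by simp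
    qed
    also have "\<dots> < 2 * (\<gamma> * c m * ((exp (5 * \<epsilon>) * t) ^ ?d * (?V + 1)))"
    proof -
      have "c (Suc m) < \<gamma> * c m" using N(3)[of m] m c[of m] by (simp add: divide_simps)
      then show ?thesis using \<open>t > 0\<close>
        by (intro mult_strict_left_mono mult_strict_right_mono) (auto intro!: mult_pos_pos add_nonneg_pos)
    qed
    also have "\<dots> = \<delta> * (c m * (t ^ ?d * ?W))"
    proof -
      have "?V + 1 > 0" by (auto intro: add_nonneg_pos)
      then have "\<gamma> * (2 * exp (5 * \<epsilon>) ^ ?d * (?V + 1)) = \<delta> * ?W" by (simp add: \<gamma>_def)
      moreover have "2 * (\<gamma> * c m * ((exp (5 * \<epsilon>) * t) ^ ?d * (?V + 1)))
          = c m * t ^ ?d * (\<gamma> * (2 * exp (5 * \<epsilon>) ^ ?d * (?V + 1)))"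
        unfolding power_mult_distrib by (simp only: mult_ac)
      ultimately show ?thesis by (simp only: mult_ac)
    qed
    \<comment> \<open>Intersecting with \<open>D\<close> is what makes the lower bound
      \<open>c m\<close> on the density available.\<close>
    also have "c m * (t ^ ?d * ?W) = c m * measure lborel (scale_set t (H \<inter> D))"
      using H oD \<open>t > 0\<close> by (simp add: measure_lborel_scale_set open_Int)
    also have "\<dots> \<le> measure ?\<nu> (scale_set t (H \<inter> D))"
    proof (rule measure_density_ge)
      show "emeasure lborel (scale_set t (H \<inter> D)) < \<infinity>"
        using bD by (intro emeasure_bounded_finite bounded_scale_set) (auto intro: bounded_Int)
      show "scale_set t (H \<inter> D) \<in> sets borel"
        using H oD \<open>t > 0\<close> by (auto intro!: borel_open open_scale_set open_Int)
      have "scale_set t D \<subseteq> scale_set (exp (-\<epsilon>) * r m) D"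
        using m \<open>t > 0\<close> by (intro scale_set_mono_of_star_shaped[OF sD])
          (auto simp: \<tau>_def exp_minus field_simps)
      also have "\<dots> \<subseteq> {x. g x > c m}" using N(5) m by auto
      finally show "c m \<le> g x" if "x \<in> scale_set t (H \<inter> D)" for x
        using that by (force simp: scale_set_def)
    qed (use gm gp fm c in \<open>auto simp: less_imp_le\<close>)
    also have "\<dots> \<le> measure ?\<nu> (scale_set t H)"
      using borel_open[OF open_scale_set[OF H(1) \<open>t > 0\<close>]]
      by (intro finite_measure_mono) (auto simp: scale_set_def)
    finally show ?thesis using \<open>0 < \<delta>\<close> by simp
  qed
  show ?thesis
    using eventually_gt_at_top[of "r N"] by eventually_elim (rule main)
qed

section \<open>Coordinatewise suprema and bluntness\<close>

lemma zero_mem_of_density_class: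
  fixes D :: "'a::euclidean_space set"
  assumes "g \<in> density_class D"
  shows "0 \<in> D"
proof -
  have gp: "0 < g 0" using assms by (auto simp: density_class_def)
  obtain c r :: "nat \<Rightarrow> real" where c: "\<And>n. 0 < c n" and r: "filterlim r at_top sequentially"
    and cr: "(\<lambda>n. c (Suc n) / c n) \<longlonglongrightarrow> 0"
    and lev: "\<And>\<epsilon>. 0 < \<epsilon> \<Longrightarrow> \<forall>\<^sub>F n in sequentially. {x. g x > c n} \<subseteq> scale_set (exp \<epsilon> * r n) D"
    using assms unfolding density_class_def mem_Collect_eq eventually_conj_iff by blast
  \<comment> \<open>Once \<open>c n < g 0\<close>, the origin lies in a level set, hence in a dilate
    of \<open>D\<close>; dilations fix the origin.\<close>
  have "\<forall>\<^sub>F n in sequentially. c n < g 0"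
    using tendsto_zero_if_ratio_tendsto_zero[OF c cr] gp by (rule order_tendstoD)
  moreover have "\<forall>\<^sub>F n in sequentially. 0 < r n"
    using r by (simp add: filterlim_at_top_dense)
  ultimately have "\<forall>\<^sub>F n in sequentially. 0 \<in> D"
    using lev[OF zero_less_one]
  proof eventually_elim
    case (elim n)
    then have "0 \<in> scale_set (exp 1 * r n) D" by auto
    then show ?case using elim by (simp add: mem_scale_set_iff)
  qed
  then show ?thesis by simp
qed

text \<open>For two coordinates these are the entries of the corner that \<open>blunt\<close> tests
  on the projection.\<close>

definition coord_sup :: "'n::finite \<Rightarrow> (real ^ 'n) set \<Rightarrow> real" where
  "coord_sup k D = Sup ((\<lambda>z. z $ k) ` D)"

lemma bdd_above_coord:
  fixes D :: "(real ^ 'n) set"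
  assumes "bounded D"
  shows "bdd_above ((\<lambda>z. z $ k) ` D)"
  using bounded_linear_image[OF assms bounded_linear_vec_nth] by (rule bounded_imp_bdd_above)

lemma coord_le_coord_sup: "bounded D \<Longrightarrow> z \<in> D \<Longrightarrow> z $ k \<le> coord_sup k D"
  unfolding coord_sup_def by (rule cSUP_upper[OF _ bdd_above_coord])

lemma coord_sup_pos:
  fixes D :: "(real ^ 'n) set"
  assumes "bounded D" "open D" "0 \<in> D"
  shows "0 < coord_sup k D"
proof -
  obtain e where e: "0 < e" "cball 0 e \<subseteq> D"
    using assms(2,3) open_contains_cball by blast
  have "axis k e = e *\<^sub>R axis k (1 :: real)" by (simp add: vec_eq_iff axis_def)
  then have "axis k e \<in> cball 0 e" using e by simp
  then have "axis k e $ k \<le> coord_sup k D"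
    using e assms(1) by (intro coord_le_coord_sup) auto
  then show ?thesis using e by simp
qed

text \<open>The half-space beyond \<open>coord_sup k D\<close> misses \<open>D\<close>. Half of the
  exponent \<open>a\<close> is therefore spent on moving it inwards until it meets \<open>D\<close>;
  the other half is the gap between dilates, and replacing \<open>t\<close> by
  \<open>exp (a / 2) * t\<close> restores the level.\<close>

lemma exterior_negligible_coord:
  fixes D :: "(real ^ 'n) set"
  assumes D: "D \<in> shape_class" and g: "g \<in> density_class D" and "0 < a" "0 < \<delta>"
  shows "\<forall>\<^sub>F t in at_top. measure (density lborel (\<lambda>x. ennreal (g x))) (- scale_set (exp a * t) D)
           < \<delta> * measure (density lborel (\<lambda>x. ennreal (g x))) {z. z $ k > t * coord_sup k D}"
proof -
  let ?\<nu> = "density lborel (\<lambda>x. ennreal (g x))"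
  let ?b = "coord_sup k D"
  define H where "H = {z :: real ^ 'n. z $ k > exp (- (a / 2)) * ?b}"
  have oD: "open D" and bD: "bounded D" using D by (auto simp: shape_class_def)
  have "0 < ?b" using bD oD zero_mem_of_density_class[OF g] by (rule coord_sup_pos)
  then have "exp (- (a / 2)) * ?b < ?b" using \<open>0 < a\<close> by simp
  then have "\<exists>z\<in>D. exp (- (a / 2)) * ?b < z $ k"
    using zero_mem_of_density_class[OF g] bdd_above_coord[OF bD, of k]
    unfolding coord_sup_def by (subst (asm) less_cSUP_iff) auto
  then have "H \<inter> D \<noteq> {}" by (auto simp: H_def)
  moreover have "open H"
    unfolding H_def by (intro open_Collect_less continuous_intros)
  ultimately have "\<forall>\<^sub>F s in at_top. measure ?\<nu> (- scale_set (exp (a / 2) * s) D) < \<delta> * measure ?\<nu> (scale_set s H)"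
    using D g assms(3,4) by (intro exterior_negligible) auto
  moreover have "filterlim (\<lambda>t. exp (a / 2) * t) at_top at_top"
    by (rule filterlim_tendsto_pos_mult_at_top[OF tendsto_const _ filterlim_ident]) auto
  ultimately have "\<forall>\<^sub>F t in at_top. measure ?\<nu> (- scale_set (exp (a / 2) * (exp (a / 2) * t)) D)
      < \<delta> * measure ?\<nu> (scale_set (exp (a / 2) * t) H)"
    by (rule eventually_compose_filterlim)
  then show ?thesis
    using eventually_gt_at_top[of 0]
  proof eventually_elim
    case (elim t)
    have "scale_set (exp (a / 2) * t) H = {z. z $ k > t * ?b}"
      using elim(2) by (auto simp: mem_scale_set_iff H_def field_simps exp_minus)
    moreover have "exp (a / 2) * (exp (a / 2) * t) = exp a * t"
      by (simp add: mult_exp_exp flip: mult.assoc)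
    ultimately show ?case using elim(1) by (simp only:)
  qed
qed

text \<open>A ball about the corner misses \<open>D_12\<close>, hence so does a small box at the
  corner. The box is written with multiplicative margins because it is used under dilation.\<close>

lemma blunt_gap:
  fixes D :: "(real ^ 'n) set"
  assumes bD: "bounded D" and pos: "0 < coord_sup i D" "0 < coord_sup j D"
    and "blunt (coord_proj i j D)"
  obtains \<eta> where "0 < \<eta>"
    "\<And>z. z \<in> D \<Longrightarrow> exp (- 2 * \<eta>) * coord_sup i D \<le> z $ i \<Longrightarrow> z $ j < exp (- 2 * \<eta>) * coord_sup j D"
proof -
  let ?b = "coord_sup i D" and ?c = "coord_sup j D"
  have "(?b, ?c) \<notin> closure (coord_proj i j D)"
    using assms(4) by (simp add: blunt_def coord_proj_def image_image coord_sup_def)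
  then obtain e where e: "0 < e" "\<And>z. z \<in> D \<Longrightarrow> e \<le> dist (z $ i, z $ j) (?b, ?c)"
    by (auto simp: closure_approachable coord_proj_def not_less)
  \<comment> \<open>Then \<open>2 * \<eta> * (?b + ?c)\<close> is \<open>e / 2\<close>, and
    \<open>1 - exp (- 2 * \<eta>)\<close> is at most \<open>2 * \<eta>\<close>.\<close>
  define \<eta> where "\<eta> = e / (4 * (?b + ?c))"
  have "0 < \<eta>" using e pos by (simp add: \<eta>_def)
  have q: "1 - exp (- 2 * \<eta>) \<le> 2 * \<eta>" using exp_ge_add_one_self[of "- 2 * \<eta>"] by simp
  have "2 * \<eta> * (?b + ?c) < e"
    using e(1) pos add_pos_pos[OF pos] by (simp add: \<eta>_def divide_simps)
  then have small: "(1 - exp (- 2 * \<eta>)) * (?b + ?c) < e"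
    using mult_right_mono[OF q, of "?b + ?c"] pos by linarith
  show thesis
  proof (rule that[OF \<open>0 < \<eta>\<close>])
    fix z assume z: "z \<in> D" "exp (- 2 * \<eta>) * ?b \<le> z $ i"
    show "z $ j < exp (- 2 * \<eta>) * ?c"
    proof (rule ccontr)
      assume "\<not> z $ j < exp (- 2 * \<eta>) * ?c"
      moreover have "z $ i \<le> ?b" "z $ j \<le> ?c" using bD z(1) by (auto intro: coord_le_coord_sup)
      moreover have "dist (z $ i, z $ j) (?b, ?c) \<le> \<bar>z $ i - ?b\<bar> + \<bar>z $ j - ?c\<bar>"
        unfolding dist_Pair_Pair dist_real_def
        using sqrt_sum_squares_le_sum_abs[of "\<bar>z $ i - ?b\<bar>" "\<bar>z $ j - ?c\<bar>"] by simp
      ultimately have "dist (z $ i, z $ j) (?b, ?c) \<le> (1 - exp (- 2 * \<eta>)) * (?b + ?c)"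
        using z by (simp add: algebra_simps)
      then show False using e(2)[OF z(1)] small by linarith
    qed
  qed
qed

section \<open>The joint exceedance function and the joint tail\<close>

lemma joint_exceedance_exists:
  assumes "prob_space M" and X[measurable]: "X \<in> borel_measurable M" and Y[measurable]: "Y \<in> borel_measurable M"
  shows "\<exists>P. is_joint_exceedance M X Y P"
proof -
  interpret prob_space M by fact
  \<comment> \<open>Well-definedness of \<open>P\<close>: where a cdf takes the same value twice,
    the variable almost surely avoids the interval in between, so the exceedance events agree up to
    a null set.\<close>
  have ae_le: "AE \<omega> in M. Z \<omega> > x \<longleftrightarrow> Z \<omega> > x'"
    if Z[measurable]: "Z \<in> borel_measurable M" and "x \<le> x'"
      and eq: "cdf (distr M borel Z) x = cdf (distr M borel Z) x'" for Z x x'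
  proof -
    interpret Z: real_distribution "distr M borel Z" using Z by (rule real_distribution_distr)
    have "prob {\<omega>\<in>space M. x < Z \<omega> \<and> Z \<omega> \<le> x'} = 0"
    proof (cases "x = x'")
      case True
      then show ?thesis by (simp add: not_le[symmetric] cong: conj_cong)
    next
      case False
      have "prob {\<omega>\<in>space M. x < Z \<omega> \<and> Z \<omega> \<le> x'} = measure (distr M borel Z) {x<..x'}"
        by (subst measure_distr) (auto simp: vimage_def Int_def intro!: arg_cong[where f="measure M"])
      then show ?thesis using Z.cdf_diff_eq[of x x'] False \<open>x \<le> x'\<close> eq by simp
    qed
    then have "AE \<omega> in M. \<not> (x < Z \<omega> \<and> Z \<omega> \<le> x')"
      by (subst (asm) prob_eq_0) auto
    then show ?thesis by eventually_elim (use \<open>x \<le> x'\<close> in auto)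
  qed
  have ae: "AE \<omega> in M. Z \<omega> > x \<longleftrightarrow> Z \<omega> > x'"
    if "Z \<in> borel_measurable M" "cdf (distr M borel Z) x = cdf (distr M borel Z) x'" for Z x x'
  proof (cases "x \<le> x'")
    case True
    from ae_le[OF that(1) True that(2)] show ?thesis .
  next
    case False
    then have "x' \<le> x" by simp
    from ae_le[OF that(1) this that(2)[symmetric]] show ?thesis by eventually_elim simp
  qed
  let ?F = "cdf (distr M borel X)" and ?G = "cdf (distr M borel Y)"
  \<comment> \<open>Outside the ranges of the cdfs \<open>SOME\<close> yields an arbitrary level;
    the defining equation says nothing there.\<close>
  define P where "P u v = prob {\<omega> \<in> space M. X \<omega> > (SOME x. ?F x = u) \<and> Y \<omega> > (SOME y. ?G y = v)}" for u v
  have "P (?F x) (?G y) = prob {\<omega> \<in> space M. X \<omega> > x \<and> Y \<omega> > y}" for x y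
  proof -
    define x' where "x' = (SOME x'. ?F x' = ?F x)"
    define y' where "y' = (SOME y'. ?G y' = ?G y)"
    have "?F x' = ?F x" "?G y' = ?G y" unfolding x'_def y'_def by (rule someI, rule refl)+
    from ae[OF X this(1)] ae[OF Y this(2)]
    have "AE \<omega> in M. (\<omega> \<in> {\<omega> \<in> space M. X \<omega> > x' \<and> Y \<omega> > y'}) = (\<omega> \<in> {\<omega> \<in> space M. X \<omega> > x \<and> Y \<omega> > y})"
      by eventually_elim auto
    then show ?thesis unfolding P_def x'_def[symmetric] y'_def[symmetric]
      by (rule finite_measure_eq_AE) auto
  qed
  then show ?thesis by (auto simp: is_joint_exceedance_def)
qed

text \<open>If \<open>y / coord_sup j D\<close> were smaller than \<open>x / coord_sup i D\<close> by more than a factor \<open>exp \<eta>\<close>,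
  the two tail probabilities could not agree; so bluntness puts the joint event outside
  a strictly larger dilate of \<open>D\<close> than the one touched by \<open>x\<close>.\<close>

lemma joint_tail_le:
  fixes D :: "(real ^ 'n) set"
  assumes "finite_measure N" and sN: "sets N = sets borel" and "0 < T" "0 < \<eta>" "\<delta> \<le> 1"
    and bD: "bounded D" "open D" and pos: "0 < coord_sup i D" "0 < coord_sup j D"
    and gap: "\<And>z. z \<in> D \<Longrightarrow> exp (- 2 * \<eta>) * coord_sup i D \<le> z $ i \<Longrightarrow> z $ j < exp (- 2 * \<eta>) * coord_sup j D"
    and Ki: "\<And>t. T \<le> t \<Longrightarrow> measure N (- scale_set (exp \<eta> * t) D) < \<delta> * measure N {z. z $ i > t * coord_sup i D}"
    and Kj: "\<And>t. T \<le> t \<Longrightarrow> measure N (- scale_set (exp \<eta> * t) D) < \<delta> * measure N {z. z $ j > t * coord_sup j D}"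
    and xs: "measure N {z. z $ i > x} = s" and ys: "measure N {z. z $ j > y} = s"
    and xy: "T * coord_sup i D \<le> x" "T * coord_sup j D \<le> y" "y / coord_sup j D \<le> x / coord_sup i D"
  shows "measure N {z. z $ i > x \<and> z $ j > y} \<le> \<delta> * s"
proof -
  let ?b = "coord_sup i D" and ?c = "coord_sup j D"
  interpret finite_measure N by fact
  have [measurable]: "{z :: real ^ 'n. z $ k > u} \<in> sets N" for k u
    unfolding sN by (intro borel_open open_Collect_less continuous_intros)
  have ext: "- scale_set t D \<in> sets N" if "0 < t" for t
    unfolding sN using that bD by (intro borel_comp borel_open open_scale_set)
  define t where "t = x / ?b"
  have t: "x = t * ?b" "T \<le> t" using pos xy by (auto simp: t_def field_simps)
  then have "0 < t" using \<open>0 < T\<close> by simp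
  define \<tau> where "\<tau> = exp (- \<eta>) * t"
  have "0 < \<tau>" using \<open>0 < t\<close> by (simp add: \<tau>_def)
  have "\<tau> * ?c \<le> y"
  proof (rule ccontr)
    assume neg: "\<not> \<tau> * ?c \<le> y"
    then have "T * ?c < \<tau> * ?c" using xy by linarith
    then have "T \<le> \<tau>" using pos by simp
    \<comment> \<open>The half-space \<open>z $ i > x\<close> misses \<open>scale_set t D\<close>,
      and \<open>t\<close> is \<open>exp \<eta> * \<tau>\<close>. So \<open>Kj\<close> at
      \<open>\<tau>\<close> makes \<open>s\<close> strictly smaller than the tail of coordinate
      \<open>j\<close> beyond \<open>y\<close>, which is \<open>s\<close> itself.\<close>
    have "s \<le> measure N (- scale_set t D)"
      unfolding xs[symmetric]
    proof (intro finite_measure_mono ext[OF \<open>0 < t\<close>] subsetI ComplI)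
      fix z assume "z \<in> {z. z $ i > x}" "z \<in> scale_set t D"
      then obtain w where "w \<in> D" "t * ?b < t * w $ i" by (auto simp: scale_set_def t)
      then show False using coord_le_coord_sup[OF bD(1), of w i] \<open>0 < t\<close> by simp
    qed
    also have "t = exp \<eta> * \<tau>" by (simp add: \<tau>_def exp_minus)
    also have "measure N (- scale_set (exp \<eta> * \<tau>) D) < \<delta> * measure N {z. z $ j > \<tau> * ?c}"
      using \<open>T \<le> \<tau>\<close> by (rule Kj)
    also have "\<dots> \<le> 1 * measure N {z. z $ j > \<tau> * ?c}"
      using \<open>\<delta> \<le> 1\<close> by (intro mult_right_mono) auto
    also have "\<dots> \<le> measure N {z. z $ j > y}"
      unfolding mult_1 using neg by (intro finite_measure_mono) auto
    finally show False using ys by simp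
  qed
  \<comment> \<open>A common point of the event and the dilate, scaled back to \<open>w\<close> in
    \<open>D\<close>, has coordinate \<open>i\<close> above \<open>exp (- \<eta>) * ?b\<close> and
    coordinate \<open>j\<close> above \<open>exp (- 2 * \<eta>) * ?c\<close>. One
    \<open>\<eta>\<close> comes from the dilate, the second from \<open>\<tau>\<close>; hence the 2
    in \<open>gap\<close>.\<close>
  have "measure N {z. z $ i > x \<and> z $ j > y} \<le> measure N (- scale_set (exp \<eta> * t) D)"
  proof (intro finite_measure_mono ext subsetI ComplI)
    fix z assume z: "z \<in> {z. z $ i > x \<and> z $ j > y}" "z \<in> scale_set (exp \<eta> * t) D"
    then obtain w where w: "w \<in> D" "t * ?b < exp \<eta> * t * w $ i" "\<tau> * ?c < exp \<eta> * t * w $ j"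
      using \<open>\<tau> * ?c \<le> y\<close> by (auto simp: scale_set_def t(1))
    have e: "exp (- 2 * \<eta>) * exp \<eta> = exp (- \<eta>)" by (simp add: mult_exp_exp)
    have "exp (- 2 * \<eta>) * ?b \<le> 1 * exp (- \<eta>) * ?b"
      using pos \<open>0 < \<eta>\<close> by (intro mult_right_mono) auto
    also have "\<dots> \<le> w $ i" using w(2) \<open>0 < t\<close> by (simp add: exp_minus field_simps)
    finally have "w $ j < exp (- 2 * \<eta>) * ?c" using w(1) gap by blast
    then have "exp \<eta> * t * w $ j < exp \<eta> * t * (exp (- 2 * \<eta>) * ?c)"
      using \<open>0 < t\<close> by simp
    also have "\<dots> = \<tau> * ?c" unfolding \<tau>_def e[symmetric] by simp
    finally show False using w(3) by simp
  qed (use \<open>0 < t\<close> in simp)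
  also have "\<dots> < \<delta> * s" using Ki[OF t(2)] xs t(1) by simp
  finally show ?thesis by simp
qed

theorem theorem3p11:
  fixes M :: "'w measure" and X :: "'w \<Rightarrow> real ^ 'n" and g :: "real ^ 'n \<Rightarrow> real"
    and D :: "(real ^ 'n) set" and i j :: 'n
  assumes "prob_space M"
    and "CARD('n) \<ge> 2" and "i \<noteq> j"
    and "D \<in> shape_class"
    and "g \<in> density_class D"
    and "distributed M lborel X (\<lambda>x. ennreal (g x))"
    and "blunt (coord_proj i j D)"
  shows "asymptotically_independent M (\<lambda>\<omega>. X \<omega> $ i) (\<lambda>\<omega>. X \<omega> $ j)"
proof -

  \<comment> \<open>The law of \<open>X\<close> and its marginals\<close>
  interpret prob_space M by fact
  define \<nu> where "\<nu> = density lborel (\<lambda>x. ennreal (g x))"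
  have X[measurable]: "X \<in> borel_measurable M" and dX: "distr M lborel X = \<nu>"
    using assms(6) by (auto simp: distributed_def \<nu>_def)
  have s\<nu>: "sets \<nu> = sets borel" by (simp add: \<nu>_def)
  interpret \<nu>: prob_space \<nu>
    using assms(5) by (simp add: density_class_def \<nu>_def)
  have gm: "g \<in> borel_measurable borel"
    using assms(5) by (intro borel_measurable_continuous_onI) (simp add: density_class_def)
  have law: "prob {\<omega> \<in> space M. X \<omega> \<in> A} = measure \<nu> A" if "A \<in> sets borel" for A
    using that by (subst dX[symmetric], subst measure_distr)
      (auto intro!: arg_cong[where f="measure M"])
  have comp[measurable]: "(\<lambda>\<omega>. X \<omega> $ k) \<in> borel_measurable M" for k
    by (rule measurable_compose[OF X]) (auto intro!: borel_measurable_continuous_onI continuous_intros)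
  have halfspace[measurable]: "{z :: real ^ 'n. z $ k > u} \<in> sets borel" for k u
    by (intro borel_open open_Collect_less continuous_intros)
  have cdf: "cdf (distr M borel (\<lambda>\<omega>. X \<omega> $ k)) u = 1 - measure \<nu> {z. z $ k > u}" for k u
  proof -
    have "cdf (distr M borel (\<lambda>\<omega>. X \<omega> $ k)) u = prob {\<omega> \<in> space M. \<not> X \<omega> $ k > u}"
      unfolding cdf_def by (subst measure_distr) (auto intro!: arg_cong[where f="measure M"])
    also have "\<dots> = 1 - prob {\<omega> \<in> space M. X \<omega> $ k > u}"
      by (intro prob_neg) auto
    also have "prob {\<omega> \<in> space M. X \<omega> $ k > u} = measure \<nu> {z. z $ k > u}"
      using law[OF halfspace] by simp
    finally show ?thesis .
  qed
  \<comment> \<open>Hyperplanes are Lebesgue null, so the marginals have no atoms.\<close>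
  have cont: "continuous_on UNIV (cdf (distr M borel (\<lambda>\<omega>. X \<omega> $ k)))" for k
  proof (intro continuous_at_imp_continuous_on ballI)
    fix u
    interpret K: real_distribution "distr M borel (\<lambda>\<omega>. X \<omega> $ k)"
      using comp by (rule real_distribution_distr)
    have cl: "{z :: real ^ 'n. z $ k = u} \<in> sets borel"
      by (intro borel_closed closed_Collect_eq continuous_intros)
    have "negligible {z :: real ^ 'n. z $ k = u}" 
      using negligible_hyperplane[of "axis k (1 :: real)" u]
      by (simp add: inner_axis' axis_eq_0_iff)
    then have "{z :: real ^ 'n. z $ k = u} \<in> null_sets lborel"
      using cl by (simp add: negligible_iff_null_sets null_sets_completion_iff)
    then have "emeasure \<nu> {z. z $ k = u} = 0"
      unfolding \<nu>_def using cl gm by (subst emeasure_density) (auto intro: nn_integral_null_set)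
    then have "measure \<nu> {z. z $ k = u} = 0" by (simp add: measure_def)
    then have "prob {\<omega> \<in> space M. X \<omega> $ k = u} = 0" using law[OF cl] by simp
    moreover have "measure (distr M borel (\<lambda>\<omega>. X \<omega> $ k)) {u} = prob {\<omega> \<in> space M. X \<omega> $ k = u}"
      by (subst measure_distr) (auto intro!: arg_cong[where f="measure M"])
    ultimately show "isCont (cdf (distr M borel (\<lambda>\<omega>. X \<omega> $ k))) u"
      by (simp add: K.isCont_cdf)
  qed

  \<comment> \<open>The limit at equal tail levels\<close>
  have oD: "open D" and bD: "bounded D" using assms(4) by (auto simp: shape_class_def)
  have pos: "0 < coord_sup k D" for k
    using bD oD zero_mem_of_density_class[OF assms(5)] by (rule coord_sup_pos)
  obtain \<eta> where "0 < \<eta>" and gap: "\<And>z. z \<in> D \<Longrightarrow> exp (- 2 * \<eta>) * coord_sup i D \<le> z $ i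
      \<Longrightarrow> z $ j < exp (- 2 * \<eta>) * coord_sup j D"
    using blunt_gap[OF bD pos pos assms(7)] by blast
  obtain P where P: "is_joint_exceedance M (\<lambda>\<omega>. X \<omega> $ i) (\<lambda>\<omega>. X \<omega> $ j) P"
    using joint_exceedance_exists[OF prob_space_axioms comp comp] by blast
  have "(\<lambda>s. P (1 - s) (1 - s)) \<in> o[at_right 0](\<lambda>s. s)"
  proof (rule landau_o.smallI)
    fix c :: real assume "0 < c"
    \<comment> \<open>The cap at 1 is the hypothesis on \<open>\<delta>\<close> in
      \<open>joint_tail_le\<close>.\<close>
    define \<delta> where "\<delta> = min c 1"
    have \<delta>: "0 < \<delta>" "\<delta> \<le> 1" "\<delta> \<le> c" using \<open>0 < c\<close> by (auto simp: \<delta>_def)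
    have "\<forall>\<^sub>F t in at_top. measure \<nu> (- scale_set (exp \<eta> * t) D) < \<delta> * measure \<nu> {z. z $ i > t * coord_sup i D}
        \<and> measure \<nu> (- scale_set (exp \<eta> * t) D) < \<delta> * measure \<nu> {z. z $ j > t * coord_sup j D} \<and> 0 < t"
      unfolding \<nu>_def using assms(4,5) \<open>0 < \<eta>\<close> \<delta>(1)
      by (intro eventually_conj exterior_negligible_coord eventually_gt_at_top)
    then obtain T where T: 
        "\<And>t. T \<le> t \<Longrightarrow> measure \<nu> (- scale_set (exp \<eta> * t) D) < \<delta> * measure \<nu> {z. z $ i > t * coord_sup i D}"
        "\<And>t. T \<le> t \<Longrightarrow> measure \<nu> (- scale_set (exp \<eta> * t) D) < \<delta> * measure \<nu> {z. z $ j > t * coord_sup j D}"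
        "\<And>t. T \<le> t \<Longrightarrow> 0 < t"
      by (auto simp: eventually_at_top_linorder)
    have "0 < T" using T(3) by simp
    \<comment> \<open>For \<open>s < s0\<close> both quantile levels lie beyond the threshold
      \<open>T\<close>, and the entry 1 keeps \<open>1 - s\<close> positive. The two tails are
      positive because \<open>\<delta>\<close> times each strictly exceeds a mass.\<close>
    define s0 where "s0 = Min {1, measure \<nu> {z. z $ i > T * coord_sup i D}, measure \<nu> {z. z $ j > T * coord_sup j D}}"
    have "0 < \<delta> * measure \<nu> {z. z $ i > T * coord_sup i D}" "0 < \<delta> * measure \<nu> {z. z $ j > T * coord_sup j D}"
      using T(1,2)[of T] by (auto intro: le_less_trans[OF measure_nonneg])
    then have "0 < s0" using \<delta>(1) by (simp add: s0_def zero_less_mult_iff)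
    have "norm (P (1 - s) (1 - s)) \<le> c * norm s" if s: "0 < s" "s < s0" for s
    proof -
      have "0 < 1 - s" "1 - s < 1" using s by (auto simp: s0_def)
      then obtain x y where xy: "cdf (distr M borel (\<lambda>\<omega>. X \<omega> $ i)) x = 1 - s" "cdf (distr M borel (\<lambda>\<omega>. X \<omega> $ j)) y = 1 - s"
        using cdf_surj_open_unit[OF prob_space_axioms comp cont] by metis
      then have m: "measure \<nu> {z. z $ i > x} = s" "measure \<nu> {z. z $ j > y} = s" by (auto simp: cdf)
      have large: "u \<le> v" if "measure \<nu> {z. z $ k > v} = s" "s < measure \<nu> {z. z $ k > u}" for k u v
      proof (rule ccontr)
        assume "\<not> u \<le> v"
        then have "measure \<nu> {z. z $ k > u} \<le> measure \<nu> {z. z $ k > v}"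
          by (intro \<nu>.finite_measure_mono) (auto simp: s\<nu>)
        then show False using that by simp
      qed
      have xT: "T * coord_sup i D \<le> x" and yT: "T * coord_sup j D \<le> y"
        using large[OF m(1)] large[OF m(2)] s by (auto simp: s0_def)
      have "measure \<nu> {z. z $ i > x \<and> z $ j > y} \<le> \<delta> * s"
      \<comment> \<open>The coordinate with the larger normalised level fixes the dilate; in the
        second case \<open>i\<close> and \<open>j\<close> exchange roles.\<close>
      proof (cases "y / coord_sup j D \<le> x / coord_sup i D")
        case True
        then show ?thesis
          using joint_tail_le[OF \<nu>.finite_measure_axioms s\<nu> \<open>0 < T\<close> \<open>0 < \<eta>\<close> \<delta>(2) bD oD pos pos gap T(1,2) m xT yT]
          by blast
      next
        case False
        \<comment> \<open>The gap is symmetric: it forbids both coordinates to be near their suprema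
          together.\<close>
        have gap': "z $ i < exp (- 2 * \<eta>) * coord_sup i D" if "z \<in> D" "exp (- 2 * \<eta>) * coord_sup j D \<le> z $ j" for z
          using gap[OF that(1)] that(2) by linarith
        have "measure \<nu> {z. z $ j > y \<and> z $ i > x} \<le> \<delta> * s"
          using joint_tail_le[OF \<nu>.finite_measure_axioms s\<nu> \<open>0 < T\<close> \<open>0 < \<eta>\<close> \<delta>(2) bD oD pos pos gap' T(2,1) m(2,1) yT xT] False
          by linarith
        then show ?thesis by (simp add: conj_commute)
      qed
      moreover have "P (1 - s) (1 - s) = measure \<nu> {z. z $ i > x \<and> z $ j > y}"
      proof -
        have "{z :: real ^ 'n. z $ i > x \<and> z $ j > y} \<in> sets borel"
          by (intro borel_open open_Collect_conj open_Collect_less continuous_intros)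
        from law[OF this] have "prob {\<omega> \<in> space M. X \<omega> $ i > x \<and> X \<omega> $ j > y} = measure \<nu> {z. z $ i > x \<and> z $ j > y}"
          by simp
        then show ?thesis
          using P xy unfolding is_joint_exceedance_def by metis
      qed
      moreover have "\<delta> * s \<le> c * s" using \<delta> s by (intro mult_right_mono) auto
      moreover have "0 \<le> measure \<nu> {z. z $ i > x \<and> z $ j > y}" by (rule measure_nonneg)
      ultimately have "\<bar>P (1 - s) (1 - s)\<bar> \<le> c * s" by linarith
      then show ?thesis using s by simp
    qed
    then show "\<forall>\<^sub>F s in at_right 0. norm (P (1 - s) (1 - s)) \<le> c * norm s"
      using \<open>0 < s0\<close> by (auto simp: eventually_at_right_field)
  qed
  then show ?thesis
    using P cont unfolding asymptotically_independent_def by blast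
qed

end
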